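(* Let $\rho,\sigma$ be density matrices of size $n\times n$ and $t\in(0,1]$. Then $$\mathsf{F}_t^{\mathrm{spec}}(\rho,\sigma)=\operatorname{Tr}\big(\rho\,(\rho^{-1}\sharp\sigma)^{2t}\big)=0\quad\Longleftrightarrow\quad \operatorname{supp}\rho\cap\operatorname{supp}\sigma=\{0\}.$$ (Equivalently, $\rho\sigma=0$.) In particular $\mathsf{F}_t^{\mathrm{spec}}(\rho,\sigma)>0$ if and only if $\rho$ and $\sigma$ have nontrivial overlapping support. For $t=0$, $\mathsf{F}_0^{\mathrm{spec}}(\rho,\sigma)=\operatorname{Tr}\rho=1$.
   Context: A density matrix (density operator, state) is a positive semidefinite complex $n\times n$ matrix of trace one; $\operatorname{supp}$ denotes the support (range) of a positive semidefinite matrix. For positive definite $A,B$, the matrix geometric mean is $A\sharp B=A^{1/2}(A^{-1/2}BA^{-1/2})^{1/2}A^{1/2}$, and the weighted spectral fidelity is $\mathsf{F}_t^{\mathrm{spec}}(\rho,\sigma)=\operatorname{Tr}\big(\rho\,(\rho^{-1}\sharp\sigma)^{2t}\big)$ for $t\in[0,1]$. Explicitly $\rho^{-1}\sharp\sigma=\rho^{-1/2}(\rho^{1/2}\sigma\rho^{1/2})^{1/2}\rho^{-1/2}$; for singular states this formula is used with inverse and fractional powers interpreted on the support of the corresponding operator (zero on its kernel), and $X^0=I$.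
   Formalization: supp ρ ∩ supp σ = {0} is replaced by orthogonal supports (ρσ = 0), as the claim fails for ρ=|0><0|, σ=|+><+| (F_t = 2^{-t}); "overlapping" means non-orthogonal. For the intersection, only F_t = 0 ⇒ trivial intersection is kept in general, and the full equivalence for commuting ρ, σ. *)

theory Defs
  imports "HOL-Analysis.Analysis" "HOL-Library.Complex_Order"
begin

definition cinner :: "complex ^ 'n \<Rightarrow> complex ^ 'n \<Rightarrow> complex" where
  "cinner x y = (\<Sum>i\<in>UNIV. cnj (x $ i) * y $ i)"

definition conj_transpose :: "complex ^ 'n ^ 'm \<Rightarrow> complex ^ 'm ^ 'n" where
  "conj_transpose A = (\<chi> i j. cnj (A $ j $ i))"

text \<open>The order on complex numbers is that of Complex_Order: \<open>0 \<le> z\<close> means that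
  \<open>z\<close> is real and nonnegative, and \<open>0 < z\<close> that it is real and positive.\<close>

definition pos_semidef :: "complex ^ 'n ^ 'n \<Rightarrow> bool" where
  "pos_semidef A \<longleftrightarrow> conj_transpose A = A \<and> (\<forall>x. 0 \<le> cinner x (A *v x))"

definition density_matrix :: "complex ^ 'n ^ 'n \<Rightarrow> bool" where
  "density_matrix A \<longleftrightarrow> pos_semidef A \<and> trace A = 1"

definition supp :: "complex ^ 'n ^ 'n \<Rightarrow> (complex ^ 'n) set" where
  "supp A = range (\<lambda>x. A *v x)"

text \<open>Absence of overlap of the supports, i.e. \<open>A ** B = 0\<close> for positive semidefinite
  \<open>A\<close>, \<open>B\<close>. For non-commuting matrices this is stronger than
  \<open>supp A \<inter> supp B = {0}\<close>: two distinct non-orthogonal lines meet only in 0.\<close>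

definition orthogonal_supp :: "complex ^ 'n ^ 'n \<Rightarrow> complex ^ 'n ^ 'n \<Rightarrow> bool" where
  "orthogonal_supp A B \<longleftrightarrow> (\<forall>x\<in>supp A. \<forall>y\<in>supp B. cinner x y = 0)"

definition unitary :: "complex ^ 'n ^ 'n \<Rightarrow> bool" where
  "unitary U \<longleftrightarrow> conj_transpose U ** U = mat 1 \<and> U ** conj_transpose U = mat 1"

definition real_diag :: "('n \<Rightarrow> real) \<Rightarrow> complex ^ 'n ^ 'n" where
  "real_diag d = (\<chi> i j. if i = j then of_real (d i) else 0)"

text \<open>Functional calculus of a Hermitian matrix. By the spectral theorem a decomposition
  \<open>A = U diag(d) U*\<close> exists, and the resulting matrix \<open>B\<close> does not depend on its choice.\<close>

definition herm_fun :: "(real \<Rightarrow> real) \<Rightarrow> complex ^ 'n ^ 'n \<Rightarrow> complex ^ 'n ^ 'n" where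
  "herm_fun f A = (THE B. \<exists>U d. unitary U
      \<and> A = U ** real_diag d ** conj_transpose U
      \<and> B = U ** real_diag (\<lambda>i. f (d i)) ** conj_transpose U)"

text \<open>Real powers of a positive semidefinite matrix: for \<open>s \<noteq> 0\<close> the power is taken on the
  support and is zero on the kernel (so negative powers are generalized inverses), while the
  power \<open>0\<close> is the identity, also on the kernel.\<close>

definition psd_powr :: "complex ^ 'n ^ 'n \<Rightarrow> real \<Rightarrow> complex ^ 'n ^ 'n" where
  "psd_powr A s =
     herm_fun (\<lambda>x. if s = 0 then 1 else if x > 0 then x powr s else 0) A"

text \<open>The geometric mean of \<open>\<rho>\<^sup>-\<^sup>1\<close> and \<open>\<sigma>\<close>. For positive definite \<open>\<rho>\<close> this is
  \<open>A\<^sup>1\<^sup>/\<^sup>2 (A\<^sup>-\<^sup>1\<^sup>/\<^sup>2 \<sigma> A\<^sup>-\<^sup>1\<^sup>/\<^sup>2)\<^sup>1\<^sup>/\<^sup>2 A\<^sup>1\<^sup>/\<^sup>2\<close> with \<open>A = \<rho>\<^sup>-\<^sup>1\<close>; for singular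
  \<open>\<rho>\<close> the powers are taken on the support.\<close>

definition inv_geo_mean :: "complex ^ 'n ^ 'n \<Rightarrow> complex ^ 'n ^ 'n \<Rightarrow> complex ^ 'n ^ 'n" where
  "inv_geo_mean \<rho> \<sigma> =
     psd_powr \<rho> (- 1 / 2)
     ** psd_powr (psd_powr \<rho> (1 / 2) ** \<sigma> ** psd_powr \<rho> (1 / 2)) (1 / 2)
     ** psd_powr \<rho> (- 1 / 2)"

definition spectral_fidelity :: "real \<Rightarrow> complex ^ 'n ^ 'n \<Rightarrow> complex ^ 'n ^ 'n \<Rightarrow> complex" where
  "spectral_fidelity t \<rho> \<sigma> = trace (\<rho> ** psd_powr (inv_geo_mean \<rho> \<sigma>) (2 * t))"

end

theory Submission
  imports Defs
begin

text \<open>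
  Write \<open>\<rho>\<close>, \<open>\<sigma>\<close> for the two states, \<open>H = \<rho>\<^sup>1\<^sup>/\<^sup>2\<close>, \<open>R = \<rho>\<^sup>-\<^sup>1\<^sup>/\<^sup>2\<close> (zero on the kernel),
  \<open>S = H \<sigma> H\<close>, \<open>M = S\<^sup>1\<^sup>/\<^sup>2\<close>, so that the geometric mean is \<open>G = R M R\<close>.  All these matrices are
  positive semidefinite.  The proof is a chain of equivalences between vanishing products:

  \<^item> the trace of a product of two positive semidefinite matrices is nonnegative, and it is zero
    only if the product is zero (\<open>pos_semidef_trace_mult\<close>).  So the fidelity is nonnegative, and
    it vanishes iff \<open>\<rho> G\<^sup>2\<^sup>t = 0\<close>;
  \<^item> a nonzero power of a positive semidefinite matrix has the same range as the matrix itself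
    (\<open>mult_psd_powr_eq_0_iff\<close>), so this is equivalent to \<open>\<rho> G = 0\<close>, whatever \<open>t > 0\<close> is;
  \<^item> \<open>\<rho> G = 0\<close> iff \<open>\<rho> \<sigma> = 0\<close> (\<open>mult_inv_geo_mean_eq_0_iff\<close>): multiplying \<open>R M R\<close> by \<open>\<rho>\<close> on both
    sides gives \<open>H M H\<close>, and for positive semidefinite \<open>B\<close> the equation \<open>C* B C = 0\<close> forces
    \<open>B C = 0\<close> (\<open>pos_semidef_congruence_eq_0D\<close>).  This removes \<open>H\<close> from the left of \<open>M\<close>, and then,
    once \<open>M\<close> is replaced by its square \<open>S\<close>, \<open>\<rho>\<close> from the left of \<open>\<sigma>\<close>.

  Since \<open>\<langle>\<rho> x, \<sigma> y\<rangle> = \<langle>x, \<rho> \<sigma> y\<rangle>\<close>, the equation \<open>\<rho> \<sigma> = 0\<close> says that the supports are orthogonal.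
  Orthogonal supports meet only in \<open>0\<close>; the converse holds for commuting \<open>\<rho>\<close>, \<open>\<sigma>\<close>, because then
  the range of \<open>\<rho> \<sigma>\<close> lies in both supports.

  All that is needed about powers is the exponent law \<open>A\<^sup>s A\<^sup>t = A\<^sup>s\<^sup>+\<^sup>t\<close> for \<open>s + t \<noteq> 0\<close>
  (\<open>psd_powr_add\<close>), with \<open>A\<^sup>1 = A\<close> and \<open>A\<^sup>0 = 1\<close>.  These rest on the spectral theorem
  (\<open>hermitian_spectral_decomposition\<close>), which is proved by maximizing the Rayleigh quotient on
  orthogonal complements of the eigenvectors already found.
\<close>

section \<open>Inner product and adjoint\<close>

lemma Re_cinner: "Re (cinner x y) = x \<bullet> y"
  by (simp add: cinner_def inner_vec_def inner_complex_def)

lemma cinner_commute: "cinner y x = cnj (cinner x y)"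
  by (simp add: cinner_def mult.commute)

lemma cinner_add_right: "cinner x (y + z) = cinner x y + cinner x z"
  by (simp add: cinner_def sum.distrib algebra_simps)

lemma cinner_zero_right [simp]: "cinner x 0 = 0"
  by (simp add: cinner_def)

lemma cinner_self: "cinner x x = of_real ((norm x)\<^sup>2)"
proof (rule complex_eqI)
  show "Im (cinner x x) = Im (of_real ((norm x)\<^sup>2))"
    using cinner_commute[of x x] by (simp add: complex_eq_iff)
qed (simp add: Re_cinner power2_norm_eq_inner)

lemma cinner_self_eq_0 [simp]: "cinner x x = 0 \<longleftrightarrow> x = 0"
  by (simp add: cinner_self)

lemma cinner_adjoint: "cinner x (A *v y) = cinner (conj_transpose A *v x) y"
proof -
  have "cinner x (A *v y) = (\<Sum>i\<in>UNIV. \<Sum>j\<in>UNIV. cnj (x $ i) * (A $ i $ j * y $ j))"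
    by (simp add: cinner_def matrix_vector_mult_def sum_distrib_left)
  also have "\<dots> = (\<Sum>j\<in>UNIV. \<Sum>i\<in>UNIV. cnj (x $ i) * (A $ i $ j * y $ j))"
    by (rule sum.swap)
  also have "\<dots> = cinner (conj_transpose A *v x) y"
    by (simp add: cinner_def matrix_vector_mult_def conj_transpose_def sum_distrib_left
        sum_distrib_right algebra_simps)
  finally show ?thesis .
qed

lemma conj_transpose_conj_transpose [simp]: "conj_transpose (conj_transpose A) = A"
  by (simp add: conj_transpose_def vec_eq_iff)

lemma conj_transpose_mult: "conj_transpose (A ** B) = conj_transpose B ** conj_transpose A"
  by (simp add: conj_transpose_def matrix_matrix_mult_def vec_eq_iff mult.commute)

lemma conj_transpose_0 [simp]: "conj_transpose 0 = 0"
  by (simp add: conj_transpose_def vec_eq_iff)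

lemma matrix_mult_zero_left [simp]: "(0 :: complex^'n^'m) ** (B :: complex^'k^'n) = 0"
  by (simp add: matrix_matrix_mult_def vec_eq_iff)

lemma matrix_mult_zero_right [simp]: "(B :: complex^'n^'m) ** (0 :: complex^'k^'n) = 0"
  by (simp add: matrix_matrix_mult_def vec_eq_iff)

section \<open>The spectral theorem\<close>

text \<open>If the form is nonnegative along the line \<open>x + s A x\<close> and zero at \<open>x\<close>, then \<open>s = 0\<close> minimizes it there, and
  its derivative at \<open>s = 0\<close>, which is \<open>2 |A x|\<^sup>2\<close>, must vanish.  Nonnegativity is required only on
  this line, so that the lemma also applies to a form that is nonnegative merely on an invariant
  subspace.\<close>

lemma hermitian_form_vanishes_imp_kernel:
  fixes A :: "complex^'n^'n"
  assumes herm: "conj_transpose A = A"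
    and nonneg: "\<And>s. 0 \<le> (x + s *\<^sub>R (A *v x)) \<bullet> (A *v (x + s *\<^sub>R (A *v x)))"
    and zero: "x \<bullet> (A *v x) = 0"
  shows "A *v x = 0"
proof (rule ccontr)
  assume "A *v x \<noteq> 0"
  have lin: "linear ((*v) A)"
    by (simp add: bounded_linear.linear)
  define y where "y = A *v x"
  define p where "p = y \<bullet> y"
  define c where "c = y \<bullet> (A *v y)"
  \<comment> \<open>Along the line the form is \<open>2 p s + c s\<^sup>2\<close>; this \<open>s < 0\<close> is small enough for the linear
    term to prevail whatever the sign of \<open>c\<close>.\<close>
  define s where "s = - p / (\<bar>c\<bar> + 1)"
  have "p > 0"
    using \<open>A *v x \<noteq> 0\<close> by (simp add: p_def y_def)
  then have "s < 0"
    by (simp add: s_def divide_neg_pos)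
  have "x \<bullet> (A *v y) = p"
    unfolding p_def Re_cinner[symmetric] cinner_adjoint[of x] herm by (simp add: y_def)
  then have "(x + s *\<^sub>R y) \<bullet> (A *v (x + s *\<^sub>R y)) = s * (2 * p + s * c)"
    using zero
    by (simp add: linear_add[OF lin] linear_scale[OF lin] inner_add p_def c_def algebra_simps
        flip: y_def)
  moreover have "2 * p + s * c > 0"
  proof -
    have "- (s * c) \<le> \<bar>s\<bar> * \<bar>c\<bar>"
      by (metis abs_ge_minus_self abs_mult)
    also have "\<dots> \<le> \<bar>s\<bar> * (\<bar>c\<bar> + 1)"
      by (simp add: mult_left_mono)
    also have "\<dots> = p"
      using \<open>p > 0\<close> by (simp add: s_def)
    finally show ?thesis
      using \<open>p > 0\<close> by linarith
  qed
  ultimately have "(x + s *\<^sub>R y) \<bullet> (A *v (x + s *\<^sub>R y)) < 0"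
    using \<open>s < 0\<close> by (simp add: mult_neg_pos)
  with nonneg[of s] show False
    by (simp add: y_def)
qed

lemma cinner_scaleR_right: "cinner x (r *\<^sub>R y) = of_real r * cinner x y"
  by (simp add: cinner_def scaleR_conv_of_real[where 'a = complex] sum_distrib_left algebra_simps)

lemma cinner_scaleR_left: "cinner (r *\<^sub>R x) y = of_real r * cinner x y"
  by (simp add: cinner_def scaleR_conv_of_real[where 'a = complex] sum_distrib_left algebra_simps)

text \<open>A unit vector \<open>x\<close> of \<open>W\<close> at which the quadratic form of \<open>A\<close> is maximal, with value \<open>m\<close>, is an
  eigenvector: the form of \<open>m - A\<close> is nonnegative on \<open>W\<close> and vanishes at \<open>x\<close>.\<close>

lemma hermitian_eigenvector_in_invariant_subspace:
  fixes A :: "complex^'n^'n"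
  assumes herm: "conj_transpose A = A"
    and W: "subspace W" and inv: "\<And>x. x \<in> W \<Longrightarrow> A *v x \<in> W"
    and w: "w \<in> W" "w \<noteq> 0"
  obtains x m where "x \<in> W" "norm x = 1" "A *v x = m *\<^sub>R x"
proof -
  have lin: "linear ((*v) A)"
    by (simp add: bounded_linear.linear)
  define K where "K = W \<inter> sphere 0 1"
  have "compact K"
    unfolding K_def by (intro closed_Int_compact closed_subspace W compact_sphere)
  moreover have "w /\<^sub>R norm w \<in> K"
    using w W by (simp add: K_def subspace_scale)
  moreover have "continuous_on K (\<lambda>x. x \<bullet> (A *v x))"
    by (intro continuous_intros matrix_vector_mult_linear_continuous_on)
  ultimately obtain x where x: "x \<in> K" and max: "\<And>y. y \<in> K \<Longrightarrow> y \<bullet> (A *v y) \<le> x \<bullet> (A *v x)"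
    by (metis continuous_attains_sup empty_iff)
  define m where "m = x \<bullet> (A *v x)"
  have le: "y \<bullet> (A *v y) \<le> m * (y \<bullet> y)" if "y \<in> W" for y
  proof (cases "y = 0")
    case False
    define n where "n = norm y"
    define z where "z = y /\<^sub>R n"
    have "z \<bullet> (A *v z) \<le> m"
      unfolding m_def z_def n_def using that False W by (intro max) (simp add: K_def subspace_scale)
    then have "n\<^sup>2 * (z \<bullet> (A *v z)) \<le> n\<^sup>2 * m"
      by (rule mult_left_mono) simp
    moreover have y: "y = n *\<^sub>R z"
      using False by (simp add: z_def n_def)
    have "y \<bullet> (A *v y) = n\<^sup>2 * (z \<bullet> (A *v z))"
      unfolding y by (simp add: linear_scale[OF lin] power2_eq_square)
    ultimately show ?thesis
      by (simp add: n_def power2_norm_eq_inner mult.commute)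
  qed simp
  define B where "B = mat (of_real m) - A"
  have B: "B *v y = m *\<^sub>R y - A *v y" for y
  proof -
    have "mat (of_real m) *v y = m *\<^sub>R y"
      by (simp add: mat_def matrix_vector_mult_def vec_eq_iff if_distrib[of "\<lambda>a. a * _"]
          scaleR_conv_of_real[where 'a = complex] cong: if_cong)
    then show ?thesis
      by (simp add: B_def matrix_vector_mult_diff_rdistrib)
  qed
  have "x \<in> W" "norm x = 1"
    using x by (auto simp: K_def)
  have "B *v x = 0"
  proof (rule hermitian_form_vanishes_imp_kernel)
    show "conj_transpose B = B"
      using herm by (auto simp: B_def conj_transpose_def mat_def vec_eq_iff)
    show "0 \<le> (x + s *\<^sub>R (B *v x)) \<bullet> (B *v (x + s *\<^sub>R (B *v x)))" for s
    proof -
      have "x + s *\<^sub>R (B *v x) \<in> W"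
        unfolding B by (intro subspace_add subspace_scale subspace_diff inv W \<open>x \<in> W\<close>)
      from le[OF this] show ?thesis
        unfolding B[of "x + _"] by (simp add: inner_diff_right)
    qed
    show "x \<bullet> (B *v x) = 0"
      using \<open>norm x = 1\<close> by (simp add: B inner_diff_right m_def flip: power2_norm_eq_inner)
  qed
  then have "A *v x = m *\<^sub>R x"
    by (simp add: B)
  with \<open>x \<in> W\<close> \<open>norm x = 1\<close> show thesis
    by (rule that)
qed

text \<open>Conjugates of the \<open>u i\<close> form the rows of a square matrix with a zero row at each index outside
  \<open>I\<close>; such a matrix is singular, and a vector of its kernel is orthogonal to the family.\<close>

lemma orthogonal_vector_to_proper_subfamily:
  fixes u :: "'n \<Rightarrow> complex^'n"
  assumes "j \<notin> I"
  obtains w where "w \<noteq> 0" "\<And>i. i \<in> I \<Longrightarrow> cinner (u i) w = 0"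
proof -
  define N where "N = (\<chi> i k. if i \<in> I then cnj (u i $ k) else 0)"
  have "row j N = 0"
    using assms by (simp add: N_def row_def vec_eq_iff)
  then have "\<not> invertible N"
    by (simp add: invertible_det_nz det_zero_row)
  then obtain w where "w \<noteq> 0" "N *v w = 0"
    by (metis invertible_left_inverse matrix_left_invertible_ker)
  moreover have "cinner (u i) w = (N *v w) $ i" if "i \<in> I" for i
    using that by (simp add: N_def matrix_vector_mult_def cinner_def)
  ultimately show thesis
    by (intro that) auto
qed

text \<open>Indexing by subsets of the coordinate type makes the full family (\<open>I = UNIV\<close>) directly
  the columns of a square matrix, without any count of dimensions.\<close>

lemma hermitian_orthonormal_eigenvectors:
  fixes A :: "complex^'n^'n" and I :: "'n set"
  assumes herm: "conj_transpose A = A"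
  shows "\<exists>u d. (\<forall>i\<in>I. A *v u i = d i *\<^sub>R u i) \<and>
           (\<forall>i\<in>I. \<forall>j\<in>I. cinner (u i) (u j) = (if i = j then 1 else 0))"
  using finite[of I]
proof (induction I rule: finite_induct)
  case (insert j I)
  then obtain u d where eig: "\<And>i. i \<in> I \<Longrightarrow> A *v u i = d i *\<^sub>R u i"
    and orth: "\<And>i k. i \<in> I \<Longrightarrow> k \<in> I \<Longrightarrow> cinner (u i) (u k) = (if i = k then 1 else 0)"
    by blast
  define W where "W = {x. \<forall>i\<in>I. cinner (u i) x = 0}"
  have W: "subspace W"
    by (auto simp: W_def subspace_def cinner_add_right cinner_scaleR_right)
  have inv: "A *v x \<in> W" if "x \<in> W" for x
    using that by (simp add: W_def cinner_adjoint herm eig cinner_scaleR_left)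
  obtain w where "w \<noteq> 0" "\<And>i. i \<in> I \<Longrightarrow> cinner (u i) w = 0"
    by (rule orthogonal_vector_to_proper_subfamily[OF insert.hyps(2), of u]) blast
  then have "w \<in> W"
    by (simp add: W_def)
  obtain x m where x: "x \<in> W" "norm x = 1" "A *v x = m *\<^sub>R x"
    by (rule hermitian_eigenvector_in_invariant_subspace[OF herm W inv \<open>w \<in> W\<close> \<open>w \<noteq> 0\<close>])
  have "cinner x x = 1" "\<And>i. i \<in> I \<Longrightarrow> cinner (u i) x = 0" "\<And>i. i \<in> I \<Longrightarrow> cinner x (u i) = 0"
    using x by (auto simp: cinner_self W_def cinner_commute[of x])
  then show ?case
    using \<open>j \<notin> I\<close> x(3) eig orth
    by (intro exI[of _ "u(j := x)"] exI[of _ "d(j := m)"]) auto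
qed simp

lemma real_diag_mult_left: "(real_diag d ** M) $ i $ j = of_real (d i) * M $ i $ j"
  by (simp add: real_diag_def matrix_matrix_mult_def if_distrib[of "\<lambda>a. a * _"] cong: if_cong)

lemma real_diag_mult_right: "(M ** real_diag d) $ i $ j = M $ i $ j * of_real (d j)"
  by (simp add: real_diag_def matrix_matrix_mult_def if_distrib[of "(*) _"] cong: if_cong)

lemma real_diag_mult_vector: "(real_diag d *v x) $ i = of_real (d i) * x $ i"
  by (simp add: real_diag_def matrix_vector_mult_def if_distrib[of "\<lambda>a. a * _"] cong: if_cong)

lemma real_diag_mult: "real_diag d ** real_diag e = real_diag (\<lambda>i. d i * e i)"
  by (simp add: vec_eq_iff real_diag_mult_left) (simp add: real_diag_def)

theorem hermitian_spectral_decomposition: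
  fixes A :: "complex^'n^'n"
  assumes "conj_transpose A = A"
  obtains U d where "unitary U" "A = U ** real_diag d ** conj_transpose U"
proof -
  obtain u :: "'n \<Rightarrow> complex^'n" and d where eig: "\<And>i. A *v u i = d i *\<^sub>R u i"
    and orth: "\<And>i j. cinner (u i) (u j) = (if i = j then 1 else 0)"
    using hermitian_orthonormal_eigenvectors[OF assms, of UNIV] by auto
  define U where "U = (\<chi> i j. u j $ i)"
  have 1: "conj_transpose U ** U = mat 1"
    using orth by (simp add: U_def conj_transpose_def matrix_matrix_mult_def mat_def cinner_def)
  then have 2: "U ** conj_transpose U = mat 1"
    by (simp add: matrix_left_right_inverse)
  have "(A ** U) $ i $ j = (U ** real_diag d) $ i $ j" for i j
    using arg_cong[OF eig[of j], of "\<lambda>x. x $ i"]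
    by (simp add: real_diag_mult_right)
      (simp add: matrix_matrix_mult_def matrix_vector_mult_def U_def scaleR_conv_of_real)
  then have "A ** U = U ** real_diag d"
    by (simp add: vec_eq_iff)
  then have "U ** real_diag d ** conj_transpose U = A"
    by (metis 2 matrix_mul_assoc matrix_mul_rid)
  with 1 2 show thesis
    by (intro that[of U d]) (auto simp: unitary_def)
qed

section \<open>Functional calculus and positive semidefinite matrices\<close>

text \<open>Independence of the decomposition: two diagonalizations of \<open>A\<close> are related by a unitary \<open>W\<close>
  whose entry \<open>W\<^sub>i\<^sub>j\<close> can be nonzero only if the \<open>i\<close>-th eigenvalue of one is the \<open>j\<close>-th
  eigenvalue of the other, and then \<open>f\<close> takes the same value at both.\<close>

lemma herm_fun_eq:
  fixes A :: "complex^'n^'n"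
  assumes U: "unitary U" and A: "A = U ** real_diag d ** conj_transpose U"
  shows "herm_fun f A = U ** real_diag (\<lambda>i. f (d i)) ** conj_transpose U"
  unfolding herm_fun_def
proof (rule the_equality)
  fix B
  assume "\<exists>V e. unitary V \<and> A = V ** real_diag e ** conj_transpose V \<and>
            B = V ** real_diag (\<lambda>i. f (e i)) ** conj_transpose V"
  then obtain V e where V: "unitary V" and A': "A = V ** real_diag e ** conj_transpose V"
    and B: "B = V ** real_diag (\<lambda>i. f (e i)) ** conj_transpose V"
    by blast
  define W where "W = conj_transpose V ** U"
  have "W ** real_diag d = conj_transpose V ** (U ** real_diag d ** conj_transpose U) ** U"
    using U by (simp add: W_def unitary_def flip: matrix_mul_assoc)
  also have "\<dots> = (conj_transpose V ** V) ** real_diag e ** W"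
    by (simp add: W_def matrix_mul_assoc flip: A A')
      (simp add: A' matrix_mul_assoc)
  also have "\<dots> = real_diag e ** W"
    using V by (simp add: unitary_def)
  finally have intertwine: "W $ i $ j * of_real (d j) = of_real (e i) * W $ i $ j" for i j
    by (metis real_diag_mult_left real_diag_mult_right)
  have "W $ i $ j * of_real (f (d j)) = of_real (f (e i)) * W $ i $ j" for i j
    using intertwine[of i j] by (cases "W $ i $ j = 0") auto
  then have *: "W ** real_diag (\<lambda>i. f (d i)) = real_diag (\<lambda>i. f (e i)) ** W"
    by (simp add: vec_eq_iff real_diag_mult_left real_diag_mult_right)
  have "U ** real_diag (\<lambda>i. f (d i)) ** conj_transpose U
      = V ** (W ** real_diag (\<lambda>i. f (d i))) ** conj_transpose U"
    using V by (simp add: W_def unitary_def matrix_mul_assoc)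
  also have "\<dots> = V ** real_diag (\<lambda>i. f (e i)) ** conj_transpose V ** (U ** conj_transpose U)"
    unfolding * by (simp add: W_def matrix_mul_assoc)
  also have "\<dots> = B"
    using U by (simp add: B unitary_def)
  finally show "B = U ** real_diag (\<lambda>i. f (d i)) ** conj_transpose U"
    by simp
qed (use assms in blast)

lemma pos_semidef_hermitian: "pos_semidef A \<Longrightarrow> conj_transpose A = A"
  by (simp add: pos_semidef_def)

lemma pos_semidef_congruence:
  assumes "pos_semidef B"
  shows "pos_semidef (conj_transpose C ** B ** C)"
proof -
  have "cinner x ((conj_transpose C ** B ** C) *v x) = cinner (C *v x) (B *v (C *v x))" for x
    by (simp add: cinner_adjoint[of x "conj_transpose C"] flip: matrix_vector_mul_assoc)
  then show ?thesis
    using assms by (simp add: pos_semidef_def conj_transpose_mult matrix_mul_assoc)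
qed

lemma pos_semidef_form_vanishes_imp_kernel:
  assumes "pos_semidef A" "cinner x (A *v x) = 0"
  shows "A *v x = 0"
proof (rule hermitian_form_vanishes_imp_kernel)
  show "0 \<le> (x + s *\<^sub>R (A *v x)) \<bullet> (A *v (x + s *\<^sub>R (A *v x)))" for s
    using assms(1) by (simp add: pos_semidef_def less_eq_complex_def flip: Re_cinner)
qed (use assms in \<open>simp_all add: pos_semidef_hermitian flip: Re_cinner\<close>)

text \<open>The form of \<open>B\<close> vanishes on the range of \<open>C\<close>, which therefore lies in the kernel of \<open>B\<close>.
  This is how a factor is cancelled from one side in a symmetric product.\<close>

lemma pos_semidef_congruence_eq_0D:
  assumes "pos_semidef B" "conj_transpose C ** B ** C = 0"
  shows "B ** C = 0"
proof -
  have "B *v (C *v x) = 0" for x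
  proof (rule pos_semidef_form_vanishes_imp_kernel[OF assms(1)])
    have "cinner (C *v x) (B *v (C *v x)) = cinner x ((conj_transpose C ** B ** C) *v x)"
      by (simp add: cinner_adjoint[of x "conj_transpose C"] flip: matrix_vector_mul_assoc)
    then show "cinner (C *v x) (B *v (C *v x)) = 0"
      by (simp add: assms(2))
  qed
  then show ?thesis
    by (simp add: matrix_eq matrix_vector_mul_assoc)
qed

lemma matrix_vector_mult_axis: "((A :: complex^'n^'m) *v axis i 1) $ j = A $ j $ i"
  by (simp add: axis_def matrix_vector_mult_def if_distrib[of "(*) _"] cong: if_cong)

lemma cinner_axis_matrix: "cinner (axis i 1) (A *v axis i 1) = A $ i $ i"
  by (simp add: cinner_def matrix_vector_mult_axis)
    (simp add: axis_def if_distrib[of cnj] if_distrib[of "\<lambda>a. a * _"] cong: if_cong)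

lemma pos_semidef_diagonal_nonneg: "pos_semidef A \<Longrightarrow> 0 \<le> A $ i $ i"
  by (metis cinner_axis_matrix pos_semidef_def)

lemma pos_semidef_trace_nonneg: "pos_semidef A \<Longrightarrow> 0 \<le> trace A"
  by (simp add: trace_def sum_nonneg pos_semidef_diagonal_nonneg)

text \<open>The diagonal entries are the values of the form at the standard basis vectors; if they
  vanish, every basis vector lies in the kernel.\<close>

lemma pos_semidef_trace_eq_0D:
  assumes "pos_semidef A" "trace A = 0"
  shows "A = 0"
proof -
  have "A $ i $ i = 0" for i
    using assms pos_semidef_diagonal_nonneg[OF assms(1)]
    by (simp add: trace_def sum_nonneg_eq_0_iff)
  then have "A *v axis i 1 = 0" for i
    by (intro pos_semidef_form_vanishes_imp_kernel[OF assms(1)]) (simp add: cinner_axis_matrix)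
  then show ?thesis
    by (metis matrix_vector_mult_axis vec_eq_iff zero_index)
qed

lemma pos_semidef_real_diag:
  assumes "\<And>i. 0 \<le> d i"
  shows "pos_semidef (real_diag d)"
proof -
  have "0 \<le> cinner x (real_diag d *v x)" for x
  proof -
    have "cinner x (real_diag d *v x) = (\<Sum>i\<in>UNIV. of_real (d i * (cmod (x $ i))\<^sup>2))"
      unfolding of_real_mult complex_norm_square
      by (simp add: cinner_def real_diag_mult_vector algebra_simps)
    also have "\<dots> \<ge> 0"
      using assms by (intro sum_nonneg) (simp add: less_eq_complex_def)
    finally show ?thesis .
  qed
  moreover have "conj_transpose (real_diag d) = real_diag d"
    by (simp add: conj_transpose_def real_diag_def vec_eq_iff)
  ultimately show ?thesis
    by (simp add: pos_semidef_def)
qed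

lemma pos_semidef_decomposition:
  fixes A :: "complex^'n^'n"
  assumes "pos_semidef A"
  obtains U d where "unitary U" "A = U ** real_diag d ** conj_transpose U" "\<And>i. 0 \<le> d i"
proof -
  obtain U d where U: "unitary U" and A: "A = U ** real_diag d ** conj_transpose U"
    using hermitian_spectral_decomposition assms pos_semidef_hermitian by blast
  have "conj_transpose U ** A ** U
      = (conj_transpose U ** U) ** real_diag d ** (conj_transpose U ** U)"
    by (simp add: A matrix_mul_assoc)
  then have "conj_transpose U ** A ** U = real_diag d"
    using U by (simp add: unitary_def)
  then have "pos_semidef (real_diag d)"
    by (metis assms pos_semidef_congruence)
  then have "0 \<le> d i" for i
    using pos_semidef_diagonal_nonneg[of "real_diag d" i]
    by (simp add: real_diag_def less_eq_complex_def)
  with U A show thesis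
    by (rule that)
qed

section \<open>Powers and products of positive semidefinite matrices\<close>

lemma pos_semidef_psd_powr:
  assumes "pos_semidef A"
  shows "pos_semidef (psd_powr A s)"
proof -
  obtain U d where U: "unitary U" "A = U ** real_diag d ** conj_transpose U"
    using pos_semidef_decomposition[OF assms] by metis
  show ?thesis
    unfolding psd_powr_def herm_fun_eq[OF U]
    using pos_semidef_congruence[OF pos_semidef_real_diag, where C = "conj_transpose U"]
    by simp
qed

lemma psd_powr_0:
  fixes A :: "complex^'n^'n"
  assumes "pos_semidef A"
  shows "psd_powr A 0 = mat 1"
proof -
  obtain U d where U: "unitary U" "A = U ** real_diag d ** conj_transpose U"
    using pos_semidef_decomposition[OF assms] by metis
  have "real_diag (\<lambda>i. 1) = (mat 1 :: complex^'n^'n)"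
    by (simp add: real_diag_def mat_def vec_eq_iff)
  with U(1) show ?thesis
    unfolding psd_powr_def herm_fun_eq[OF U] by (simp add: unitary_def)
qed

lemma psd_powr_1:
  assumes "pos_semidef A"
  shows "psd_powr A 1 = A"
proof -
  obtain U d where U: "unitary U" "A = U ** real_diag d ** conj_transpose U"
    and d: "\<And>i. 0 \<le> d i"
    using pos_semidef_decomposition[OF assms] by metis
  have "(if d i > 0 then d i powr 1 else 0) = d i" for i
    using d[of i] by simp
  then show ?thesis
    unfolding psd_powr_def herm_fun_eq[OF U] using U(2) by simp
qed

text \<open>The exponent \<open>s + t = 0\<close> is excluded: \<open>A\<^sup>s A\<^sup>-\<^sup>s\<close> is the projection onto the support, whereas
  \<open>A\<^sup>0\<close> is the identity.  An exponent \<open>s = 0\<close> or \<open>t = 0\<close> alone is harmless.\<close>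

lemma psd_powr_add:
  assumes "pos_semidef A" "s + t \<noteq> 0"
  shows "psd_powr A s ** psd_powr A t = psd_powr A (s + t)"
proof -
  obtain U d where U: "unitary U" "A = U ** real_diag d ** conj_transpose U"
    using pos_semidef_decomposition[OF assms(1)] by metis
  define f where "f r = (\<lambda>x::real. if r = 0 then 1 else if x > 0 then x powr r else 0)" for r
  have f: "psd_powr A r = U ** real_diag (\<lambda>i. f r (d i)) ** conj_transpose U" for r
    unfolding psd_powr_def herm_fun_eq[OF U] f_def ..
  have "f s x * f t x = f (s + t) x" for x
    using assms(2) by (simp add: f_def powr_add)
  then have "real_diag (\<lambda>i. f s (d i)) ** real_diag (\<lambda>i. f t (d i)) = real_diag (\<lambda>i. f (s + t) (d i))"
    by (simp add: real_diag_mult)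
  moreover have "psd_powr A s ** psd_powr A t = U ** real_diag (\<lambda>i. f s (d i))
      ** (conj_transpose U ** U) ** real_diag (\<lambda>i. f t (d i)) ** conj_transpose U"
    by (simp add: f matrix_mul_assoc)
  ultimately show ?thesis
    using U(1) by (simp add: f unitary_def flip: matrix_mul_assoc) (simp add: matrix_mul_assoc)
qed

text \<open>Each of \<open>A\<close> and \<open>A\<^sup>s\<close> is the other one times a power of \<open>A\<close>, the exponents being \<open>1 - s\<close>
  and \<open>s - 1\<close>.\<close>

lemma mult_psd_powr_eq_0_iff:
  assumes "pos_semidef A" "s \<noteq> 0"
  shows "N ** psd_powr A s = 0 \<longleftrightarrow> N ** A = 0"
proof
  assume "N ** psd_powr A s = 0"
  moreover have "A = psd_powr A s ** psd_powr A (1 - s)"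
    using assms by (simp add: psd_powr_add psd_powr_1)
  ultimately show "N ** A = 0"
    by (metis matrix_mul_assoc matrix_mult_zero_left)
next
  assume "N ** A = 0"
  moreover have "psd_powr A s = A ** psd_powr A (s - 1)"
    using assms psd_powr_add[of A 1 "s - 1"] by (simp add: psd_powr_1)
  ultimately show "N ** psd_powr A s = 0"
    by (metis matrix_mul_assoc matrix_mult_zero_left)
qed

lemma psd_powr_mult_eq_0_iff:
  assumes "pos_semidef A" "s \<noteq> 0"
  shows "psd_powr A s ** N = 0 \<longleftrightarrow> A ** N = 0"
proof
  assume "psd_powr A s ** N = 0"
  moreover have "A = psd_powr A (1 - s) ** psd_powr A s"
    using assms by (simp add: psd_powr_add psd_powr_1)
  ultimately show "A ** N = 0"
    by (metis matrix_mul_assoc matrix_mult_zero_right)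
next
  assume "A ** N = 0"
  moreover have "psd_powr A s = psd_powr A (s - 1) ** A"
    using assms psd_powr_add[of A "s - 1" 1] by (simp add: psd_powr_1)
  ultimately show "psd_powr A s ** N = 0"
    by (metis matrix_mul_assoc matrix_mult_zero_right)
qed

lemma pos_semidef_mult_eq_0_commute:
  assumes "pos_semidef A" "pos_semidef B"
  shows "A ** B = 0 \<longleftrightarrow> B ** A = 0"
  by (metis assms pos_semidef_hermitian conj_transpose_mult conj_transpose_0)

text \<open>With \<open>R = B\<^sup>1\<^sup>/\<^sup>2\<close>, cyclicity turns \<open>Tr (A B)\<close> into the trace of the positive semidefinite
  matrix \<open>R A R\<close>, which is zero if its trace is; then \<open>A R = 0\<close> and \<open>A B = A R R = 0\<close>.\<close>

lemma pos_semidef_trace_mult: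
  assumes A: "pos_semidef A" and B: "pos_semidef B"
  shows "0 \<le> trace (A ** B)" "trace (A ** B) = 0 \<longleftrightarrow> A ** B = 0"
proof -
  define R where "R = psd_powr B (1/2)"
  have R: "conj_transpose R = R"
    using B by (simp add: R_def pos_semidef_hermitian pos_semidef_psd_powr)
  have "R ** R = B"
    using B by (simp add: R_def psd_powr_add psd_powr_1)
  then have trace: "trace (A ** B) = trace (R ** A ** R)"
    by (metis matrix_mul_assoc trace_mul_sym)
  have psd: "pos_semidef (R ** A ** R)"
    using pos_semidef_congruence[OF A, of R] by (simp add: R)
  then show "0 \<le> trace (A ** B)"
    by (simp add: trace pos_semidef_trace_nonneg)
  have "A ** B = 0" if "trace (A ** B) = 0"
  proof -
    have "R ** A ** R = 0"
      using psd that by (simp add: trace pos_semidef_trace_eq_0D)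
    then have "A ** R = 0"
      using pos_semidef_congruence_eq_0D[OF A, of R] by (simp add: R)
    then show ?thesis
      using B by (simp add: R_def mult_psd_powr_eq_0_iff)
  qed
  then show "trace (A ** B) = 0 \<longleftrightarrow> A ** B = 0"
    by (auto simp: trace_def)
qed

section \<open>Vanishing of the spectral fidelity\<close>

lemma pos_semidef_inv_geo_mean:
  assumes "pos_semidef A" "pos_semidef B"
  shows "pos_semidef (inv_geo_mean A B)"
proof -
  have "conj_transpose (psd_powr A s) = psd_powr A s" for s
    using assms(1) by (simp add: pos_semidef_hermitian pos_semidef_psd_powr)
  then show ?thesis
    unfolding inv_geo_mean_def
    by (metis assms(2) pos_semidef_congruence pos_semidef_psd_powr)
qed

text \<open>For singular \<open>A\<close> the factors \<open>A\<^sup>-\<^sup>1\<^sup>/\<^sup>2\<close> cannot be cancelled by inversion, but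
  \<open>A A\<^sup>-\<^sup>1\<^sup>/\<^sup>2 = A\<^sup>1\<^sup>/\<^sup>2\<close> holds on the kernel as well, so multiplication by \<open>A\<close> on both sides replaces
  them by positive powers.\<close>

lemma mult_inv_geo_mean_eq_0_iff:
  assumes A: "pos_semidef A" and B: "pos_semidef B"
  shows "A ** inv_geo_mean A B = 0 \<longleftrightarrow> A ** B = 0"
proof -
  define H where "H = psd_powr A (1/2)"
  define S where "S = H ** B ** H"
  define R where "R = psd_powr A (- 1/2)"
  define M where "M = psd_powr S (1/2)"
  have G: "inv_geo_mean A B = R ** M ** R"
    by (simp add: inv_geo_mean_def R_def M_def S_def H_def)
  have H: "conj_transpose H = H" "H ** H = A"
    using A by (simp_all add: H_def pos_semidef_hermitian pos_semidef_psd_powr psd_powr_add psd_powr_1)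
  have AR: "A ** R = H" "R ** A = H"
    using A psd_powr_add[of A 1 "-1/2"] psd_powr_add[of A "-1/2" 1]
    by (simp_all add: R_def H_def psd_powr_1)
  have S: "pos_semidef S"
    using pos_semidef_congruence[OF B, of H] by (simp add: S_def H)
  then have M: "pos_semidef M"
    by (simp add: M_def pos_semidef_psd_powr)
  show ?thesis
  proof
    assume "A ** inv_geo_mean A B = 0"
    then have "H ** M ** R = 0"
      by (simp add: G matrix_mul_assoc AR)
    then have "H ** M ** H = 0"
      by (metis AR(2) matrix_mul_assoc matrix_mult_zero_left)
    then have "M ** H = 0"
      using pos_semidef_congruence_eq_0D[OF M, of H] by (simp add: H)
    then have "S ** H = 0"
      using S by (simp add: M_def psd_powr_mult_eq_0_iff)
    then have "A ** B ** A = 0"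
      unfolding S_def by (metis H(2) matrix_mul_assoc matrix_mult_zero_right)
    then have "B ** A = 0"
      using pos_semidef_congruence_eq_0D[OF B, of A] A by (simp add: pos_semidef_hermitian)
    then show "A ** B = 0"
      using A B by (simp add: pos_semidef_mult_eq_0_commute)
  next
    assume "A ** B = 0"
    then have "H ** B = 0"
      using A by (simp add: H_def psd_powr_mult_eq_0_iff)
    then have "S = 0"
      by (simp add: S_def)
    then have "M = 0"
      using psd_powr_mult_eq_0_iff[OF S, of "1/2" "mat 1"] by (simp add: M_def)
    then show "A ** inv_geo_mean A B = 0"
      by (simp add: G)
  qed
qed

lemma orthogonal_supp_iff:
  assumes "conj_transpose A = A"
  shows "orthogonal_supp A B \<longleftrightarrow> A ** B = 0"
proof
  assume orth: "orthogonal_supp A B"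
  have "(A ** B) *v y = 0" for y
  proof -
    define z where "z = (A ** B) *v y"
    have "cinner z z = cinner (A *v z) (B *v y)"
      by (simp add: z_def cinner_adjoint[of _ A] assms flip: matrix_vector_mul_assoc)
    also have "\<dots> = 0"
      using orth by (simp add: orthogonal_supp_def supp_def)
    finally show ?thesis
      by (simp add: z_def)
  qed
  then show "A ** B = 0"
    by (simp add: matrix_eq)
next
  assume "A ** B = 0"
  then have "cinner (A *v x) (B *v y) = 0" for x y
    by (metis assms cinner_adjoint cinner_zero_right matrix_vector_mul_assoc matrix_vector_mult_0)
  then show "orthogonal_supp A B"
    by (auto simp: orthogonal_supp_def supp_def)
qed

lemma zero_in_supp: "0 \<in> supp A"
  unfolding supp_def by (metis matrix_vector_mult_0_right rangeI)

lemma supp_inter_eq_0_if_orthogonal: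
  assumes "orthogonal_supp A B"
  shows "supp A \<inter> supp B = {0}"
  using assms zero_in_supp[of A] zero_in_supp[of B]
  by (fastforce simp: orthogonal_supp_def)

lemma mult_eq_0_if_commute_supp_inter:
  assumes "A ** B = B ** A" "supp A \<inter> supp B = {0}"
  shows "A ** B = 0"
proof -
  have "(A ** B) *v x \<in> supp A \<inter> supp B" for x
  proof
    show "(A ** B) *v x \<in> supp A"
      by (simp add: supp_def flip: matrix_vector_mul_assoc)
    show "(A ** B) *v x \<in> supp B"
      by (simp add: supp_def assms(1) flip: matrix_vector_mul_assoc)
  qed
  then show ?thesis
    using assms(2) by (simp add: matrix_eq)
qed

theorem spectral_fidelity_pos_semidef:
  assumes A: "pos_semidef A" and B: "pos_semidef B"
  shows "0 \<le> spectral_fidelity t A B"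
    and "t \<noteq> 0 \<Longrightarrow> spectral_fidelity t A B = 0 \<longleftrightarrow> A ** B = 0"
    and "spectral_fidelity 0 A B = trace A"
proof -
  have G: "pos_semidef (inv_geo_mean A B)"
    using assms by (rule pos_semidef_inv_geo_mean)
  note GP = pos_semidef_psd_powr[OF G]
  show "0 \<le> spectral_fidelity t A B"
    unfolding spectral_fidelity_def by (rule pos_semidef_trace_mult[OF A GP])
  show "spectral_fidelity t A B = 0 \<longleftrightarrow> A ** B = 0" if "t \<noteq> 0"
    using that A B G GP
    by (simp add: spectral_fidelity_def pos_semidef_trace_mult mult_psd_powr_eq_0_iff
        mult_inv_geo_mean_eq_0_iff)
  show "spectral_fidelity 0 A B = trace A"
    using G by (simp add: spectral_fidelity_def psd_powr_0)
qed

theorem proposition3p6: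
  fixes \<rho> \<sigma> :: "complex ^ 'n ^ 'n"
  assumes "density_matrix \<rho>" and "density_matrix \<sigma>"
  shows "(\<forall>t::real. 0 < t \<and> t \<le> 1 \<longrightarrow>
           (spectral_fidelity t \<rho> \<sigma> = 0 \<longleftrightarrow> orthogonal_supp \<rho> \<sigma>)
         \<and> (spectral_fidelity t \<rho> \<sigma> = 0 \<longleftrightarrow> \<rho> ** \<sigma> = 0)
         \<and> (spectral_fidelity t \<rho> \<sigma> > 0 \<longleftrightarrow> \<not> orthogonal_supp \<rho> \<sigma>)
         \<and> (spectral_fidelity t \<rho> \<sigma> = 0 \<longrightarrow> supp \<rho> \<inter> supp \<sigma> = {0})
         \<and> (supp \<rho> \<inter> supp \<sigma> \<noteq> {0} \<longrightarrow> spectral_fidelity t \<rho> \<sigma> > 0)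
         \<and> (\<rho> ** \<sigma> = \<sigma> ** \<rho> \<longrightarrow>
              (spectral_fidelity t \<rho> \<sigma> = 0 \<longleftrightarrow> supp \<rho> \<inter> supp \<sigma> = {0})
            \<and> (spectral_fidelity t \<rho> \<sigma> > 0 \<longleftrightarrow> supp \<rho> \<inter> supp \<sigma> \<noteq> {0})))
       \<and> spectral_fidelity 0 \<rho> \<sigma> = trace \<rho> \<and> trace \<rho> = 1"
proof -
  have psd: "pos_semidef \<rho>" "pos_semidef \<sigma>" and tr: "trace \<rho> = 1"
    using assms by (simp_all add: density_matrix_def)
  have orth: "orthogonal_supp \<rho> \<sigma> \<longleftrightarrow> \<rho> ** \<sigma> = 0"
    using psd by (simp add: orthogonal_supp_iff pos_semidef_hermitian)
  have eq_0: "spectral_fidelity t \<rho> \<sigma> = 0 \<longleftrightarrow> \<rho> ** \<sigma> = 0" if "0 < t" for t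
    using spectral_fidelity_pos_semidef(2)[OF psd] that by simp
  have pos: "spectral_fidelity t \<rho> \<sigma> > 0 \<longleftrightarrow> \<rho> ** \<sigma> \<noteq> 0" if "0 < t" for t
    using spectral_fidelity_pos_semidef(1)[OF psd, of t] eq_0[OF that] by (simp add: less_le)
  have triv: "supp \<rho> \<inter> supp \<sigma> = {0}" if "\<rho> ** \<sigma> = 0"
    using that supp_inter_eq_0_if_orthogonal orth by blast
  have comm: "\<rho> ** \<sigma> = 0" if "\<rho> ** \<sigma> = \<sigma> ** \<rho>" "supp \<rho> \<inter> supp \<sigma> = {0}"
    using that by (rule mult_eq_0_if_commute_supp_inter)
  show ?thesis
    using triv comm by (auto simp: orth eq_0 pos tr spectral_fidelity_pos_semidef(3)[OF psd])
qed

end
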